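(* Let $n\geq 9$ with $n\equiv 0 \pmod 3$, and let $G$ be the $n$-vertex nested triangles graph on vertices $v_1,\dots,v_n$. Let $\tau(v_i)=i$ for $i=1,\dots,n$. Then every planar straight-line grid drawing story of the graph story $\langle G,\tau,9\rangle$ lies on a grid of size $\Omega(n)\times\Omega(n)$; i.e., there is an absolute constant $c>0$ such that for every such $n$ and every such drawing story, any grid $[a,b]\times[c',d]$ whose bounding box encloses all the drawings of the story has width and height at least $c\cdot n$.
   Context: The $n$-vertex nested triangles graph ($n\equiv 0\pmod 3$) has vertices $v_1,\dots,v_n$ and consists of the 3-cycles $C_i=(v_{i-2},v_{i-1},v_i)$ for $i=3,6,\dots,n$, together with the edges $(v_i,v_{i+3})$ for $i=1,\dots,n-3$. A graph story $\langle G,\tau,W\rangle$ consists of a graph $G$ with $n$ vertices, a bijection $\tau:V(G)\to\{1,\dots,n\}$, and a positive integer $W$ (the window size); for $t=1,\dots,n+W-1$, $G_t$ is the subgraph of $G$ induced by $\{v: t-W<\tau(v)\leq t\}$. A drawing story of $\langle G,\tau,W\rangle$ is a sequence $\Gamma_1,\dots,\Gamma_{n+W-1}$ where $\Gamma_t$ is a drawing of $G_t$, every vertex is drawn at the same point in all $\Gamma_t$ containing it, and every edge is drawn by the same curve in all $\Gamma_t$ containing it. It is planar, straight-line, or on the grid if every $\Gamma_t$ is planar, has straight-line segment edges, or has all vertices at integer-coordinate points, respectively. The grid $[a,b]\times[c,d]$ (integers $a<b$, $c<d$) has width $b-a+1$ and height $d-c+1$; a drawing lies on a $w\times h$ grid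 if it is enclosed by the bounding box of some grid of width $w$ and height $h$. *)

theory Defs
  imports "HOL-Analysis.Analysis"
begin

record 'a ugraph =
  verts :: "'a set"
  edges :: "'a set set"

definition simple_graph :: "'a ugraph \<Rightarrow> bool" where
  "simple_graph G \<longleftrightarrow> finite (verts G) \<and>
     (\<forall>e\<in>edges G. e \<subseteq> verts G \<and> card e = 2)"

definition induced_subgraph :: "'a ugraph \<Rightarrow> 'a set \<Rightarrow> 'a ugraph" where
  "induced_subgraph G S = \<lparr> verts = verts G \<inter> S, edges = {e \<in> edges G. e \<subseteq> S} \<rparr>"

definition graph_story :: "'a ugraph \<Rightarrow> ('a \<Rightarrow> nat) \<Rightarrow> nat \<Rightarrow> bool" where
  "graph_story G \<tau> W \<longleftrightarrow> simple_graph G \<and>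
     bij_betw \<tau> (verts G) {1..card (verts G)} \<and> W > 0"

text \<open>The window condition is stated over the integers because \<open>t - W\<close> may be negative.\<close>

definition story_graph :: "'a ugraph \<Rightarrow> ('a \<Rightarrow> nat) \<Rightarrow> nat \<Rightarrow> nat \<Rightarrow> 'a ugraph" where
  "story_graph G \<tau> W t =
     induced_subgraph G {v. int t - int W < int (\<tau> v) \<and> int (\<tau> v) \<le> int t}"

definition story_times :: "'a ugraph \<Rightarrow> nat \<Rightarrow> nat set" where
  "story_times G W = {1..card (verts G) + W - 1}"

text \<open>A curve is recorded as a point set, so that it carries neither an orientation
  nor a parametrization.\<close>

record 'a drawing =
  pos :: "'a \<Rightarrow> real \<times> real"
  curve :: "'a set \<Rightarrow> (real \<times> real) set"

definition drawing_of :: "'a ugraph \<Rightarrow> 'a drawing \<Rightarrow> bool" where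
  "drawing_of G \<Gamma> \<longleftrightarrow> inj_on (pos \<Gamma>) (verts G) \<and>
     (\<forall>u v. {u, v} \<in> edges G \<longrightarrow>
        (\<exists>g. arc g \<and> {pathstart g, pathfinish g} = {pos \<Gamma> u, pos \<Gamma> v} \<and>
             curve \<Gamma> {u, v} = path_image g))"

definition planar_drawing :: "'a ugraph \<Rightarrow> 'a drawing \<Rightarrow> bool" where
  "planar_drawing G \<Gamma> \<longleftrightarrow>
     (\<forall>e\<in>edges G. \<forall>f\<in>edges G. e \<noteq> f \<longrightarrow> curve \<Gamma> e \<inter> curve \<Gamma> f \<subseteq> pos \<Gamma> ` (e \<inter> f)) \<and>
     (\<forall>e\<in>edges G. \<forall>v\<in>verts G. pos \<Gamma> v \<in> curve \<Gamma> e \<longrightarrow> v \<in> e)"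

definition straight_line_drawing :: "'a ugraph \<Rightarrow> 'a drawing \<Rightarrow> bool" where
  "straight_line_drawing G \<Gamma> \<longleftrightarrow>
     (\<forall>u v. {u, v} \<in> edges G \<longrightarrow> curve \<Gamma> {u, v} = closed_segment (pos \<Gamma> u) (pos \<Gamma> v))"

definition grid_drawing :: "'a ugraph \<Rightarrow> 'a drawing \<Rightarrow> bool" where
  "grid_drawing G \<Gamma> \<longleftrightarrow> (\<forall>v\<in>verts G. fst (pos \<Gamma> v) \<in> \<int> \<and> snd (pos \<Gamma> v) \<in> \<int>)"

definition drawn_points :: "'a ugraph \<Rightarrow> 'a drawing \<Rightarrow> (real \<times> real) set" where
  "drawn_points G \<Gamma> = pos \<Gamma> ` verts G \<union> (\<Union>e\<in>edges G. curve \<Gamma> e)"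

definition drawing_story ::
  "'a ugraph \<Rightarrow> ('a \<Rightarrow> nat) \<Rightarrow> nat \<Rightarrow> (nat \<Rightarrow> 'a drawing) \<Rightarrow> bool" where
  "drawing_story G \<tau> W \<Gamma> \<longleftrightarrow> graph_story G \<tau> W \<and>
     (\<forall>t\<in>story_times G W. drawing_of (story_graph G \<tau> W t) (\<Gamma> t)) \<and>
     (\<forall>s\<in>story_times G W. \<forall>t\<in>story_times G W.
        (\<forall>v \<in> verts (story_graph G \<tau> W s) \<inter> verts (story_graph G \<tau> W t).
           pos (\<Gamma> s) v = pos (\<Gamma> t) v) \<and>
        (\<forall>e \<in> edges (story_graph G \<tau> W s) \<inter> edges (story_graph G \<tau> W t).
           curve (\<Gamma> s) e = curve (\<Gamma> t) e))"

definition planar_story ::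
  "'a ugraph \<Rightarrow> ('a \<Rightarrow> nat) \<Rightarrow> nat \<Rightarrow> (nat \<Rightarrow> 'a drawing) \<Rightarrow> bool" where
  "planar_story G \<tau> W \<Gamma> \<longleftrightarrow>
     (\<forall>t\<in>story_times G W. planar_drawing (story_graph G \<tau> W t) (\<Gamma> t))"

definition straight_line_story ::
  "'a ugraph \<Rightarrow> ('a \<Rightarrow> nat) \<Rightarrow> nat \<Rightarrow> (nat \<Rightarrow> 'a drawing) \<Rightarrow> bool" where
  "straight_line_story G \<tau> W \<Gamma> \<longleftrightarrow>
     (\<forall>t\<in>story_times G W. straight_line_drawing (story_graph G \<tau> W t) (\<Gamma> t))"

definition grid_story ::
  "'a ugraph \<Rightarrow> ('a \<Rightarrow> nat) \<Rightarrow> nat \<Rightarrow> (nat \<Rightarrow> 'a drawing) \<Rightarrow> bool" where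
  "grid_story G \<tau> W \<Gamma> \<longleftrightarrow>
     (\<forall>t\<in>story_times G W. grid_drawing (story_graph G \<tau> W t) (\<Gamma> t))"

definition story_enclosed ::
  "'a ugraph \<Rightarrow> ('a \<Rightarrow> nat) \<Rightarrow> nat \<Rightarrow> (nat \<Rightarrow> 'a drawing) \<Rightarrow> int \<Rightarrow> int \<Rightarrow> int \<Rightarrow> int \<Rightarrow> bool" where
  "story_enclosed G \<tau> W \<Gamma> x\<^sub>1 x\<^sub>2 y\<^sub>1 y\<^sub>2 \<longleftrightarrow>
     (\<forall>t\<in>story_times G W. drawn_points (story_graph G \<tau> W t) (\<Gamma> t)
        \<subseteq> {of_int x\<^sub>1..of_int x\<^sub>2} \<times> {of_int y\<^sub>1..of_int y\<^sub>2})"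

text \<open>Both the width \<open>x\<^sub>2 - x\<^sub>1 + 1\<close> of a grid \<open>[x\<^sub>1, x\<^sub>2] \<times> [y\<^sub>1, y\<^sub>2]\<close> and its height count
  grid lines, not lengths.\<close>

definition grid_extent :: "int \<Rightarrow> int \<Rightarrow> int" where
  "grid_extent lo hi = hi - lo + 1"

text \<open>The vertex \<open>v\<^sub>i\<close> is represented by the number \<open>i\<close>. The definition is only meaningful
  when 3 divides \<open>n\<close>.\<close>

definition nested_triangles :: "nat \<Rightarrow> nat ugraph" where
  "nested_triangles n =
     \<lparr> verts = {1..n},
       edges = (\<Union>i \<in> {i \<in> {3..n}. 3 dvd i}. {{i - 2, i - 1}, {i - 1, i}, {i, i - 2}})
               \<union> {{i, i + 3} | i. 1 \<le> i \<and> i + 3 \<le> n} \<rparr>"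

lemma graph_story_nested_triangles:
  assumes "W > 0"
  shows "graph_story (nested_triangles n) (\<lambda>i. i) W"
proof -
  have "simple_graph (nested_triangles n)"
    by (auto simp: simple_graph_def nested_triangles_def card_insert_if)
  then show ?thesis
    using assms by (simp add: graph_story_def nested_triangles_def bij_betw_def)
qed

end

theory Submission
  imports Defs
begin

text \<open>
  At time \<open>t = 3k\<close> three consecutive triangles are fully visible. If the middle one contained neither
  of its two neighbours, both would be drawn outside it, and adding a point inside it joined to its
  corners would give a planar drawing of a subdivision of \<open>K\<^bsub>3,3\<^esub>\<close>. Hence the middle triangle
  strictly contains one of its neighbours. Strict containment is asymmetric, so from a triangle in
  the middle of the sequence onwards, in one of the two directions, every triangle contains the
  next; this gives about \<open>n/6\<close> nested triangles with integer coordinates, and every nesting step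
  widens the bounding box by at least two in each coordinate direction.
\<close>

section \<open>Theta curves\<close>

text \<open>Off \<open>S\<close> the plane splits into two disjoint open sets, the inside and the
  outside, so a connected set avoiding \<open>S\<close> cannot have points in both.\<close>

lemma connected_subset_inside:
  fixes S R :: "'a::real_normed_vector set"
  assumes "open (inside S)" "closed S" "connected R" "R \<inter> S = {}" "R \<inter> inside S \<noteq> {}"
  shows "R \<subseteq> inside S"
proof -
  have "open (outside S)"
    using assms(2) by (rule open_outside)
  moreover have "R \<subseteq> inside S \<union> outside S"
    using assms(4) inside_Un_outside[of S] by blast
  ultimately show ?thesis
    using connectedD[OF assms(3,1), of "outside S"] inside_Int_outside[of S] assms(5)
    by blast
qed

text \<open>The Jordan curve theorem for the loop along \<open>c1\<close> and back along
  \<open>c2\<close>. A theta curve contains three such loops, one for each pair of its arcs.\<close>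

lemma Jordan_two_arcs:
  fixes c1 c2 :: "real \<Rightarrow> complex"
  defines "J \<equiv> path_image c1 \<union> path_image c2"
  assumes "arc c1" "arc c2" "pathstart c1 = p" "pathstart c2 = p"
      and "pathfinish c1 = q" "pathfinish c2 = q" "path_image c1 \<inter> path_image c2 = {p, q}"
  shows "inside J \<noteq> {}" "open (inside J)" "connected (inside J)" "bounded (inside J)"
    "connected (outside J)" "frontier (inside J) = J" "compact J"
proof -
  let ?c = "c1 +++ reversepath c2"
  have "simple_path ?c" "pathfinish ?c = pathstart ?c" and J: "path_image ?c = J"
    using assms by (auto intro!: simple_path_join_loop simp: arc_reversepath path_image_join)
  then show "inside J \<noteq> {}" "open (inside J)" "connected (inside J)" "bounded (inside J)"
    "connected (outside J)" "frontier (inside J) = J"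
    using Jordan_inside_outside[of ?c] by auto
  show "compact J"
    using assms by (auto simp: J_def intro!: compact_Un compact_arc_image)
qed

text \<open>Here \<open>c3\<close> is a chord cutting the inside of the loop of \<open>c1\<close>
  and \<open>c2\<close> into two faces. Touching the chord traps \<open>R\<close> in one face, and
  the closure of that face misses the inner part of the opposite arc.\<close>

lemma inside_theta_arc_not_touching:
  fixes c1 c2 c3 :: "real \<Rightarrow> complex"
  assumes arcs: "arc c1" "arc c2" "arc c3"
      and starts: "pathstart c1 = p" "pathstart c2 = p" "pathstart c3 = p"
      and finishes: "pathfinish c1 = q" "pathfinish c2 = q" "pathfinish c3 = q"
      and meets: "path_image c1 \<inter> path_image c2 = {p, q}"
        "path_image c1 \<inter> path_image c3 = {p, q}" "path_image c2 \<inter> path_image c3 = {p, q}"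
      and R: "connected R"
        "R \<inter> (path_image c1 \<union> path_image c2 \<union> path_image c3) = {}"
      and touch: "closure R \<inter> (path_image c1 - {p, q}) \<noteq> {}"
        "closure R \<inter> (path_image c2 - {p, q}) \<noteq> {}" "closure R \<inter> (path_image c3 - {p, q}) \<noteq> {}"
      and mid: "path_image c3 \<inter> inside (path_image c1 \<union> path_image c2) \<noteq> {}"
    shows False
proof -
  let ?J12 = "path_image c1 \<union> path_image c2"
    and ?J13 = "path_image c1 \<union> path_image c3"
    and ?J23 = "path_image c2 \<union> path_image c3"
  note J12 = Jordan_two_arcs[OF arcs(1,2) starts(1,2) finishes(1,2) meets(1)]
    and J13 = Jordan_two_arcs[OF arcs(1,3) starts(1,3) finishes(1,3) meets(2)]
    and J23 = Jordan_two_arcs[OF arcs(2,3) starts(2,3) finishes(2,3) meets(3)]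
  have "p \<noteq> q"
    using arcs(1) starts(1) finishes(1) arc_distinct_ends by blast
  then have parts: "inside ?J13 \<union> inside ?J23 \<union> (path_image c3 - {p, q}) = inside ?J12"
    using split_inside_simple_closed_curve[OF arc_imp_simple_path[OF arcs(1)] starts(1) finishes(1)
        arc_imp_simple_path[OF arcs(2)] starts(2) finishes(2)
        arc_imp_simple_path[OF arcs(3)] starts(3) finishes(3) _ meets(1-3) mid] by metis
  \<comment> \<open>A point where the closure of \<open>R\<close> meets the chord has an open
    neighbourhood inside the loop, so \<open>R\<close> itself enters the inside.\<close>
  have "closure R \<inter> inside ?J12 \<noteq> {}"
    using touch(3) parts by blast
  then have "R \<inter> inside ?J12 \<noteq> {}"
    using J12(2) open_Int_closure_eq_empty[of "inside ?J12" R] by blast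
  then consider "R \<inter> inside ?J13 \<noteq> {}" | "R \<inter> inside ?J23 \<noteq> {}"
    using parts R(2) by blast
  then show False
  proof cases
    case 1
    then have "R \<subseteq> inside ?J13"
      using R J13(2,7) by (intro connected_subset_inside compact_imp_closed) auto
    then have "closure R \<subseteq> inside ?J13 \<union> ?J13"
      using J13(6) closure_mono closure_Un_frontier by metis
    then show False
      using touch(2) meets parts inside_no_overlap[of ?J12] by blast
  next
    case 2
    then have "R \<subseteq> inside ?J23"
      using R J23(2,7) by (intro connected_subset_inside compact_imp_closed) auto
    then have "closure R \<subseteq> inside ?J23 \<union> ?J23"
      using J23(6) closure_mono closure_Un_frontier by metis
    then show False
      using touch(1) meets parts inside_no_overlap[of ?J12] by blast
  qed
qed

text \<open>If the two insides met, the first, which is connected and avoids the second loop, would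
  lie within the second. Passing to closures would squeeze \<open>c2\<close> into the second loop,
  hence into \<open>{p, q}\<close>, but an arc is infinite.\<close>

lemma insides_disjoint:
  fixes c1 c2 c3 :: "real \<Rightarrow> complex"
  assumes arcs: "arc c1" "arc c2" "arc c3"
      and starts: "pathstart c1 = p" "pathstart c2 = p" "pathstart c3 = p"
      and finishes: "pathfinish c1 = q" "pathfinish c2 = q" "pathfinish c3 = q"
      and meets: "path_image c1 \<inter> path_image c2 = {p, q}"
        "path_image c1 \<inter> path_image c3 = {p, q}" "path_image c2 \<inter> path_image c3 = {p, q}"
      and out: "path_image c3 \<inter> inside (path_image c1 \<union> path_image c2) = {}"
        "path_image c2 \<inter> inside (path_image c1 \<union> path_image c3) = {}"
    shows "inside (path_image c1 \<union> path_image c2) \<inter> inside (path_image c1 \<union> path_image c3) = {}"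
proof (rule ccontr)
  let ?J12 = "path_image c1 \<union> path_image c2"
    and ?J13 = "path_image c1 \<union> path_image c3"
  note J12 = Jordan_two_arcs[OF arcs(1,2) starts(1,2) finishes(1,2) meets(1)]
    and J13 = Jordan_two_arcs[OF arcs(1,3) starts(1,3) finishes(1,3) meets(2)]
  assume "inside ?J12 \<inter> inside ?J13 \<noteq> {}"
  moreover have "inside ?J12 \<inter> ?J13 = {}"
    using out(1) inside_no_overlap[of ?J12] by blast
  ultimately have "inside ?J12 \<subseteq> inside ?J13"
    using J12 J13 by (intro connected_subset_inside compact_imp_closed) auto
  then have "?J12 \<subseteq> inside ?J13 \<union> ?J13"
    using J12(6) J13(6) closure_mono closure_Un_frontier by (metis le_sup_iff)
  then have "path_image c2 \<subseteq> path_image c1 \<union> path_image c3"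
    using out(2) by blast
  then have "path_image c2 \<subseteq> {p, q}"
    using meets by blast
  moreover have "infinite (path_image c2)"
    using arc_image_uncountable[OF arcs(2)] countable_finite by blast
  ultimately show False
    using finite_subset by blast
qed

text \<open>Otherwise a point inside one of the three cycles would lie outside the other two, which meet
  in an arc, and Janiszewski's theorem would connect it to infinity off the whole theta curve.\<close>

lemma theta_some_arc_inside:
  fixes c1 c2 c3 :: "real \<Rightarrow> complex"
  assumes arcs: "arc c1" "arc c2" "arc c3"
      and starts: "pathstart c1 = p" "pathstart c2 = p" "pathstart c3 = p"
      and finishes: "pathfinish c1 = q" "pathfinish c2 = q" "pathfinish c3 = q"
      and meets: "path_image c1 \<inter> path_image c2 = {p, q}"
        "path_image c1 \<inter> path_image c3 = {p, q}" "path_image c2 \<inter> path_image c3 = {p, q}"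
    shows "path_image c3 \<inter> inside (path_image c1 \<union> path_image c2) \<noteq> {} \<or>
      path_image c2 \<inter> inside (path_image c1 \<union> path_image c3) \<noteq> {} \<or>
      path_image c1 \<inter> inside (path_image c2 \<union> path_image c3) \<noteq> {}"
proof (rule ccontr)
  let ?J12 = "path_image c1 \<union> path_image c2"
    and ?J13 = "path_image c1 \<union> path_image c3"
    and ?J23 = "path_image c2 \<union> path_image c3"
  note J12 = Jordan_two_arcs[OF arcs(1,2) starts(1,2) finishes(1,2) meets(1)]
    and J13 = Jordan_two_arcs[OF arcs(1,3) starts(1,3) finishes(1,3) meets(2)]
    and J23 = Jordan_two_arcs[OF arcs(2,3) starts(2,3) finishes(2,3) meets(3)]
  assume "\<not> ?thesis"
  then have out: "path_image c3 \<inter> inside ?J12 = {}" "path_image c2 \<inter> inside ?J13 = {}"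
    "path_image c1 \<inter> inside ?J23 = {}"
    by auto
  obtain a where a: "a \<in> inside ?J12"
    using J12(1) by blast
  have a_out: "a \<in> outside ?J13" "a \<in> outside ?J23"
  proof -
    have "a \<notin> inside ?J13"
      using insides_disjoint[OF arcs starts finishes meets out(1,2)] a by blast
    moreover have "a \<notin> inside ?J23"
      using insides_disjoint[of c2 c1 c3 p q] arcs starts finishes meets out a
      by (auto simp: Int_commute Un_commute)
    ultimately show "a \<in> outside ?J13" "a \<in> outside ?J23"
      using a out inside_no_overlap[of ?J12] inside_Un_outside[of ?J13] inside_Un_outside[of ?J23]
      by blast+
  qed
  \<comment> \<open>All three loops and their insides are bounded, so a point \<open>w\<close> off
    all of them exists; it plays the role of infinity.\<close>
  have "bounded (inside ?J12 \<union> inside ?J13 \<union> inside ?J23 \<union> ?J12 \<union> ?J13 \<union> ?J23)"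
    by (intro bounded_Un[THEN iffD2] conjI J12(4) J13(4) J23(4)
        compact_imp_bounded compact_arc_image arcs)
  then obtain w where w: "w \<notin> inside ?J12 \<union> inside ?J13 \<union> inside ?J23 \<union> ?J12 \<union> ?J13 \<union> ?J23"
    by (metis UNIV_eq_I not_bounded_UNIV)
  then have w_out: "w \<in> outside ?J12" "w \<in> outside ?J13" "w \<in> outside ?J23"
    using inside_Un_outside[of ?J12] inside_Un_outside[of ?J13] inside_Un_outside[of ?J23]
    by blast+
  have "connected_component (- ?J13) a w" "connected_component (- ?J23) a w"
    unfolding connected_component_def
    using a_out w_out J13(5) J23(5) outside_no_overlap[of ?J13] outside_no_overlap[of ?J23]
      disjoint_eq_subset_Compl by metis+
  moreover have "?J13 \<inter> ?J23 = path_image c3"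
    using meets pathstart_in_path_image[of c3] pathfinish_in_path_image[of c3] starts finishes by auto
  ultimately have "connected_component (- (?J13 \<union> ?J23)) a w"
    using J13(7) J23(7) arcs(3)
    by (intro Janiszewski[of ?J13 ?J23])
      (simp_all only: compact_imp_closed connected_arc_image)
  then have "connected_component (- ?J12) a w"
    by (rule connected_component_of_subset) blast
  then have "w \<in> inside ?J12"
    using a by (rule inside_same_component)
  then show False
    using w_out(1) inside_Int_outside[of ?J12] by blast
qed

text \<open>A topological form of the nonplanarity of K_{3,3}: \<open>p\<close>, \<open>q\<close>
  and the connected set \<open>R\<close> form one side, and the points where \<open>R\<close>
  touches the three arcs form the other. Some arc runs inside the loop of the other two, and after
  relabelling it is the chord of \<open>inside_theta_arc_not_touching\<close>.\<close>

lemma theta_not_touching_all_arcs: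
  fixes c1 c2 c3 :: "real \<Rightarrow> complex"
  assumes arcs: "arc c1" "arc c2" "arc c3"
      and starts: "pathstart c1 = p" "pathstart c2 = p" "pathstart c3 = p"
      and finishes: "pathfinish c1 = q" "pathfinish c2 = q" "pathfinish c3 = q"
      and meets: "path_image c1 \<inter> path_image c2 = {p, q}"
        "path_image c1 \<inter> path_image c3 = {p, q}" "path_image c2 \<inter> path_image c3 = {p, q}"
      and R: "connected R"
        "R \<inter> (path_image c1 \<union> path_image c2 \<union> path_image c3) = {}"
      and touch: "closure R \<inter> (path_image c1 - {p, q}) \<noteq> {}"
        "closure R \<inter> (path_image c2 - {p, q}) \<noteq> {}" "closure R \<inter> (path_image c3 - {p, q}) \<noteq> {}"
    shows False
proof -
  have symm: "path_image c2 \<inter> path_image c1 = {p, q}"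
    "path_image c3 \<inter> path_image c1 = {p, q}" "path_image c3 \<inter> path_image c2 = {p, q}"
    "R \<inter> (path_image c1 \<union> path_image c3 \<union> path_image c2) = {}"
    "R \<inter> (path_image c2 \<union> path_image c3 \<union> path_image c1) = {}"
    using meets R(2) by (simp_all only: Int_commute Un_ac)
  from theta_some_arc_inside[OF arcs starts finishes meets] show False
  proof (elim disjE)
    assume "path_image c3 \<inter> inside (path_image c1 \<union> path_image c2) \<noteq> {}"
    then show False
      by (rule inside_theta_arc_not_touching[OF arcs starts finishes meets R touch])
  next
    assume "path_image c2 \<inter> inside (path_image c1 \<union> path_image c3) \<noteq> {}"
    then show False
      by (rule inside_theta_arc_not_touching[OF arcs(1,3,2) starts(1,3,2) finishes(1,3,2)
            meets(2,1) symm(3) R(1) symm(4) touch(1,3,2)])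
  next
    assume "path_image c1 \<inter> inside (path_image c2 \<union> path_image c3) \<noteq> {}"
    then show False
      by (rule inside_theta_arc_not_touching[OF arcs(2,3,1) starts(2,3,1) finishes(2,3,1)
            meets(3) symm(1,2) R(1) symm(5) touch(2,3,1)])
  qed
qed

section \<open>Triangles with outer webs\<close>

text \<open>If the centroid were on the line through \<open>a\<close> and \<open>b\<close>, then
  \<open>c\<close>, being three times the centroid minus \<open>a\<close> and \<open>b\<close>,
  would be on it too. The use is that segments from the centroid to two corners share only the
  centroid.\<close>

lemma collinear_centroid:
  fixes a b c :: "'a::euclidean_space"
  assumes "\<not> collinear {a, b, c}"
  shows "\<not> collinear {a, (1/3) *\<^sub>R (a + b + c), b}"
proof
  let ?o = "(1/3) *\<^sub>R (a + b + c)"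
  assume "collinear {a, ?o, b}"
  moreover have "a \<noteq> b"
    using assms by auto
  ultimately have "?o \<in> affine hull {a, b}"
    using collinear_3_affine_hull[of a b ?o] by (simp add: insert_commute)
  then obtain u v where uv: "?o = u *\<^sub>R a + v *\<^sub>R b" "u + v = 1"
    by (auto simp: affine_hull_2)
  have "c = 3 *\<^sub>R ?o - a - b"
    by simp
  also have "\<dots> = (3 * u - 1) *\<^sub>R a + (3 * v - 1) *\<^sub>R b"
    unfolding uv(1) by (simp add: algebra_simps)
  finally have "c \<in> affine hull {a, b}"
    using uv(2) unfolding affine_hull_2 by fastforce
  then show False
    using assms \<open>a \<noteq> b\<close> collinear_3_affine_hull[of a b c] by (simp add: insert_commute)
qed

text \<open>The legs are open at the \<open>b\<^sub>i\<close>, so that the web around a drawn triangle is disjoint from it.\<close>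

definition web :: "'a::real_vector \<Rightarrow> 'a \<Rightarrow> 'a \<Rightarrow> 'a \<Rightarrow> 'a \<Rightarrow> 'a \<Rightarrow> 'a set" where
  "web a1 a2 a3 b1 b2 b3 =
     closed_segment a1 a2 \<union> closed_segment a2 a3 \<union> closed_segment a3 a1 \<union>
     (closed_segment a1 b1 - {b1}) \<union> (closed_segment a2 b2 - {b2}) \<union> (closed_segment a3 b3 - {b3})"

lemma half_open_segment:
  fixes a b :: "'a::euclidean_space"
  assumes "a \<noteq> b"
  shows "connected (closed_segment a b - {b})" "b \<in> closure (closed_segment a b - {b})"
proof -
  have sub: "open_segment a b \<subseteq> closed_segment a b - {b}"
    by (auto simp: open_segment_def)
  have "closure (open_segment a b) = closed_segment a b"
    using assms by simp
  then show "connected (closed_segment a b - {b})" "b \<in> closure (closed_segment a b - {b})"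
    using connected_intermediate_closure[OF convex_connected[OF convex_open_segment] sub] closure_mono[OF sub] by auto
qed

lemma web_connected:
  fixes a1 :: "'a::euclidean_space"
  assumes "a1 \<noteq> b1" "a2 \<noteq> b2" "a3 \<noteq> b3"
  shows "connected (web a1 a2 a3 b1 b2 b3)"
proof -
  have "connected (closed_segment a1 a2 \<union> closed_segment a2 a3 \<union> closed_segment a3 a1)" (is "connected ?T")
    by (intro connected_Un connected_segment) auto
  then have "connected (?T \<union> (closed_segment a1 b1 - {b1}))"
    by (rule connected_Un[OF _ half_open_segment(1)[OF assms(1)]]) (use assms in auto)
  then have "connected (?T \<union> (closed_segment a1 b1 - {b1}) \<union> (closed_segment a2 b2 - {b2}))"
    by (rule connected_Un[OF _ half_open_segment(1)[OF assms(2)]]) (use assms in auto)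
  then show ?thesis
    unfolding web_def
    by (rule connected_Un[OF _ half_open_segment(1)[OF assms(3)]]) (use assms in auto)
qed

text \<open>Although the legs omit the corners \<open>b1\<close>, \<open>b2\<close>,
  \<open>b3\<close>, the web still accumulates there. This provides the touching points demanded by
  \<open>theta_not_touching_all_arcs\<close>.\<close>

lemma web_closure:
  fixes a1 :: "'a::euclidean_space"
  assumes "a1 \<noteq> b1" "a2 \<noteq> b2" "a3 \<noteq> b3"
  shows "b1 \<in> closure (web a1 a2 a3 b1 b2 b3)" "b2 \<in> closure (web a1 a2 a3 b1 b2 b3)"
    "b3 \<in> closure (web a1 a2 a3 b1 b2 b3)"
proof -
  have arms: "closed_segment a1 b1 - {b1} \<subseteq> web a1 a2 a3 b1 b2 b3"
    "closed_segment a2 b2 - {b2} \<subseteq> web a1 a2 a3 b1 b2 b3"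
    "closed_segment a3 b3 - {b3} \<subseteq> web a1 a2 a3 b1 b2 b3"
    by (auto simp: web_def)
  show "b1 \<in> closure (web a1 a2 a3 b1 b2 b3)" "b2 \<in> closure (web a1 a2 a3 b1 b2 b3)"
    "b3 \<in> closure (web a1 a2 a3 b1 b2 b3)"
    by (rule subsetD[OF closure_mono half_open_segment(2)]; fact)+
qed

text \<open>A drawing of \<open>K\<^bsub>3,3\<^esub>\<close>: the centroid of the triangle and the vertex \<open>a1\<close> are joined by a theta
  curve through the three \<open>b\<^sub>i\<close>, and the web of the \<open>c\<^sub>i\<close> touches all three arcs.\<close>

lemma no_two_webs_outside_triangle:
  fixes a1 a2 a3 b1 b2 b3 c1 c2 c3 :: complex
  assumes ncol: "\<not> collinear {b1, b2, b3}"
    and A: "web a1 a2 a3 b1 b2 b3 \<inter> convex hull {b1, b2, b3} = {}"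
    and C: "web c1 c2 c3 b1 b2 b3 \<inter> convex hull {b1, b2, b3} = {}"
    and AC: "web a1 a2 a3 b1 b2 b3 \<inter> web c1 c2 c3 b1 b2 b3 = {}"
    and arms: "closed_segment a1 b1 \<inter> closed_segment a2 b2 = {}"
      "closed_segment a1 b1 \<inter> closed_segment a3 b3 = {}"
      "closed_segment a2 b2 \<inter> closed_segment a3 b3 = {}"
    and arm1: "closed_segment a1 b1 \<inter> closed_segment a1 a2 \<subseteq> {a1}"
      "closed_segment a1 b1 \<inter> closed_segment a1 a3 \<subseteq> {a1}"
    and arm2: "closed_segment a2 b2 \<inter> closed_segment a1 a2 \<subseteq> {a2}"
      "closed_segment a2 b2 \<inter> closed_segment a1 a3 = {}"
    and arm3: "closed_segment a3 b3 \<inter> closed_segment a1 a2 = {}"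
      "closed_segment a3 b3 \<inter> closed_segment a1 a3 \<subseteq> {a3}"
    and sides: "closed_segment a1 a2 \<inter> closed_segment a1 a3 \<subseteq> {a1}"
  shows False
proof -
  define ctr where "ctr = (1/3) *\<^sub>R (b1 + b2 + b3)"
  let ?H = "convex hull {b1, b2, b3}"
  let ?W = "web a1 a2 a3 b1 b2 b3" and ?R = "web c1 c2 c3 b1 b2 b3"
  have ncol_ctr: "\<not> collinear {b1, ctr, b2}" "\<not> collinear {b1, ctr, b3}" "\<not> collinear {b2, ctr, b3}"
    using collinear_centroid[of b1 b2 b3] collinear_centroid[of b1 b3 b2]
      collinear_centroid[of b2 b3 b1] ncol
    by (simp_all add: ctr_def insert_commute add_ac)
  have ctr_ne: "ctr \<noteq> b1" "ctr \<noteq> b2" "ctr \<noteq> b3"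
    using ncol_ctr by auto
  have spokes: "closed_segment ctr b1 \<inter> closed_segment ctr b2 = {ctr}"
    "closed_segment ctr b1 \<inter> closed_segment ctr b3 = {ctr}"
    "closed_segment ctr b2 \<inter> closed_segment ctr b3 = {ctr}"
    using Int_closed_segment[of ctr b1 b2] Int_closed_segment[of ctr b1 b3]
      Int_closed_segment[of ctr b2 b3] ncol_ctr
    by (simp_all add: closed_segment_commute insert_commute)
  have bH: "b1 \<in> ?H" "b2 \<in> ?H" "b3 \<in> ?H"
    by (simp_all add: hull_inc)
  have "ctr = (1/3) *\<^sub>R b1 + (1/3) *\<^sub>R b2 + (1/3) *\<^sub>R b3"
    by (simp add: ctr_def algebra_simps)
  then have "ctr \<in> ?H"
    unfolding convex_hull_3 by fastforce
  with bH have spokes_H: "closed_segment ctr b1 \<subseteq> ?H" "closed_segment ctr b2 \<subseteq> ?H" "closed_segment ctr b3 \<subseteq> ?H"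
    by (simp_all add: closed_segment_subset convex_convex_hull)
  have W: "closed_segment a1 a2 \<subseteq> ?W" "closed_segment a1 a3 \<subseteq> ?W" "closed_segment a1 b1 - {b1} \<subseteq> ?W"
    "closed_segment a2 b2 - {b2} \<subseteq> ?W" "closed_segment a3 b3 - {b3} \<subseteq> ?W"
    by (auto simp: web_def closed_segment_commute)
  have aW: "a1 \<in> ?W" "a2 \<in> ?W" "a3 \<in> ?W"
    by (auto simp: web_def)
  have cR: "c1 \<in> ?R" "c2 \<in> ?R" "c3 \<in> ?R"
    by (auto simp: web_def)
  \<comment> \<open>The disjoint arms separate \<open>a1\<close> from the other \<open>a\<close>'s
    and from \<open>b2\<close> and \<open>b3\<close>; the remaining inequalities hold because the
    webs miss the hull, which contains the corners and the centroid.\<close>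
  have ne: "a1 \<noteq> a2" "a1 \<noteq> a3" "a1 \<noteq> b1" "a2 \<noteq> b2" "a3 \<noteq> b3" "c1 \<noteq> b1" "c2 \<noteq> b2" "c3 \<noteq> b3"
    "a1 \<noteq> b2" "a1 \<noteq> b3" "a1 \<noteq> ctr"
    using arms aW cR A C bH \<open>ctr \<in> ?H\<close> by (auto simp: disjoint_iff)
  \<comment> \<open>A corner on a foreign spoke would be a common point of two spokes, hence the
    centroid.\<close>
  have b_spokes: "b2 \<notin> closed_segment ctr b1" "b3 \<notin> closed_segment ctr b1"
    "b1 \<notin> closed_segment ctr b2" "b3 \<notin> closed_segment ctr b2"
    "b1 \<notin> closed_segment ctr b3" "b2 \<notin> closed_segment ctr b3"
    using spokes ctr_ne ends_in_segment(2)[of b1 ctr] ends_in_segment(2)[of b2 ctr]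
      ends_in_segment(2)[of b3 ctr] by (metis IntI singletonD)+
  have arm_H: "closed_segment a1 b1 \<inter> ?H \<subseteq> {b1}" "closed_segment a2 b2 \<inter> ?H \<subseteq> {b2}"
    "closed_segment a3 b3 \<inter> ?H \<subseteq> {b3}"
    using W A by blast+
  have spoke_arm: "closed_segment ctr b1 \<inter> closed_segment a1 b1 \<subseteq> {b1}"
    "closed_segment ctr b2 \<inter> closed_segment a2 b2 \<subseteq> {b2}"
    "closed_segment ctr b3 \<inter> closed_segment a3 b3 \<subseteq> {b3}"
    using arm_H spokes_H by blast+
  have spoke_other_arm: "closed_segment ctr b1 \<inter> closed_segment a2 b2 = {}"
    "closed_segment ctr b1 \<inter> closed_segment a3 b3 = {}"
    "closed_segment ctr b2 \<inter> closed_segment a1 b1 = {}"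
    "closed_segment ctr b2 \<inter> closed_segment a3 b3 = {}"
    "closed_segment ctr b3 \<inter> closed_segment a1 b1 = {}"
    "closed_segment ctr b3 \<inter> closed_segment a2 b2 = {}"
    using arm_H spokes_H b_spokes by blast+
  have spoke_side: "closed_segment ctr b1 \<inter> closed_segment a1 a2 = {}"
    "closed_segment ctr b1 \<inter> closed_segment a1 a3 = {}"
    "closed_segment ctr b2 \<inter> closed_segment a1 a2 = {}"
    "closed_segment ctr b2 \<inter> closed_segment a1 a3 = {}"
    "closed_segment ctr b3 \<inter> closed_segment a1 a2 = {}"
    "closed_segment ctr b3 \<inter> closed_segment a1 a3 = {}"
    using spokes_H W A by blast+
  \<comment> \<open>All three arcs leave the centroid through a different corner; \<open>g1\<close>
    ends after its leg, while \<open>g2\<close> and \<open>g3\<close> continue from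
    \<open>a2\<close> and \<open>a3\<close> along a side to \<open>a1\<close>.\<close>
  define g1 where "g1 = linepath ctr b1 +++ linepath b1 a1"
  define g2 where "g2 = linepath ctr b2 +++ (linepath b2 a2 +++ linepath a2 a1)"
  define g3 where "g3 = linepath ctr b3 +++ (linepath b3 a3 +++ linepath a3 a1)"
  have img: "path_image g1 = closed_segment ctr b1 \<union> closed_segment a1 b1"
    "path_image g2 = closed_segment ctr b2 \<union> closed_segment a2 b2 \<union> closed_segment a1 a2"
    "path_image g3 = closed_segment ctr b3 \<union> closed_segment a3 b3 \<union> closed_segment a1 a3"
    by (auto simp: g1_def g2_def g3_def path_image_join closed_segment_commute)
  have R_disjoint: "?R \<inter> (path_image g1 \<union> path_image g2 \<union> path_image g3) = {}"
  proof -
    have "path_image g1 \<subseteq> ?H \<union> ?W" "path_image g2 \<subseteq> ?H \<union> ?W" "path_image g3 \<subseteq> ?H \<union> ?W"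
      using spokes_H W bH unfolding img by blast+
    then show ?thesis
      using C AC by blast
  qed
  show False
  proof (rule theta_not_touching_all_arcs[of g1 g2 g3 ctr a1 ?R])
    show "arc g1"
      unfolding g1_def using spoke_arm ne ctr_ne
      by (intro arc_join arc_linepath) (auto simp: closed_segment_commute)
    show "arc g2"
      unfolding g2_def using spoke_arm spoke_side ne ctr_ne arm2
      by (intro arc_join arc_linepath) (auto simp: closed_segment_commute path_image_join)
    show "arc g3"
      unfolding g3_def using spoke_arm spoke_side ne ctr_ne arm3
      by (intro arc_join arc_linepath) (auto simp: closed_segment_commute path_image_join)
    show "path_image g1 \<inter> path_image g2 = {ctr, a1}"
      unfolding img using spoke_arm spoke_other_arm spoke_side spokes arms arm1 by auto
    show "path_image g1 \<inter> path_image g3 = {ctr, a1}"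
      unfolding img using spoke_arm spoke_other_arm spoke_side spokes arms arm1 by auto
    show "path_image g2 \<inter> path_image g3 = {ctr, a1}"
      unfolding img using spoke_arm spoke_other_arm spoke_side spokes arms arm2 arm3 sides by auto
    show "connected ?R"
      using ne by (intro web_connected)
    show "?R \<inter> (path_image g1 \<union> path_image g2 \<union> path_image g3) = {}"
      by (fact R_disjoint)
    \<comment> \<open>The touching points are the corners, each an inner point of its arc.\<close>
    have "b1 \<in> closure ?R \<inter> (path_image g1 - {ctr, a1})" "b2 \<in> closure ?R \<inter> (path_image g2 - {ctr, a1})"
      "b3 \<in> closure ?R \<inter> (path_image g3 - {ctr, a1})"
      using web_closure[OF ne(6-8)] ne ctr_ne by (auto simp: img)
    then show "closure ?R \<inter> (path_image g1 - {ctr, a1}) \<noteq> {}"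
      "closure ?R \<inter> (path_image g2 - {ctr, a1}) \<noteq> {}" "closure ?R \<inter> (path_image g3 - {ctr, a1}) \<noteq> {}"
      by blast+
  qed (simp_all add: g1_def g2_def g3_def)
qed

section \<open>Three consecutive triangles\<close>

text \<open>Taking \<open>e\<close> and an edge at \<open>v\<close> for the two edges shows that no vertex \<open>v\<close> lies on an edge \<open>e\<close>
  not containing it.\<close>

definition plane_embedding :: "'v set set \<Rightarrow> ('v \<Rightarrow> 'a::real_vector) \<Rightarrow> bool" where
  "plane_embedding E f \<longleftrightarrow> inj_on f (\<Union>E) \<and>
     (\<forall>d\<in>E. \<forall>e\<in>E. d \<noteq> e \<longrightarrow> convex hull (f ` d) \<inter> convex hull (f ` e) \<subseteq> f ` (d \<inter> e))"

lemma plane_embedding_disjoint: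
  assumes "plane_embedding E f" "{u, v} \<in> E" "{x, y} \<in> E" "{u, v} \<inter> {x, y} = {}"
  shows "closed_segment (f u) (f v) \<inter> closed_segment (f x) (f y) = {}"
proof -
  have "{u, v} \<noteq> {x, y}"
    using assms(4) by blast
  then show ?thesis
    using assms unfolding plane_embedding_def segment_convex_hull
    by (metis image_empty image_insert subset_empty)
qed

lemma plane_embedding_adjacent:
  assumes "plane_embedding E f" "{u, v} \<in> E" "{u, w} \<in> E" "v \<noteq> w"
  shows "closed_segment (f u) (f v) \<inter> closed_segment (f u) (f w) \<subseteq> {f u}"
proof -
  have "{u, v} \<noteq> {u, w}" "f ` ({u, v} \<inter> {u, w}) \<subseteq> {f u}"
    using assms(4) by (auto simp: doubleton_eq_iff)
  then show ?thesis
    using assms unfolding plane_embedding_def segment_convex_hull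
    by (metis image_empty image_insert subset_trans)
qed

text \<open>Of three collinear points one lies between the others, and then the two edges at an
  outer point overlap beyond their common endpoint.\<close>

lemma triangle_not_collinear:
  fixes f :: "'v \<Rightarrow> 'a::euclidean_space"
  assumes "plane_embedding E f" "{{x, y}, {y, z}, {z, x}} \<subseteq> E" "distinct [x, y, z]"
  shows "\<not> collinear {f x, f y, f z}"
proof
  have "inj_on f (\<Union>E)" "{x, y, z} \<subseteq> \<Union>E"
    using assms by (auto simp: plane_embedding_def)
  then have ne: "f x \<noteq> f y" "f y \<noteq> f z" "f z \<noteq> f x"
    using assms(3) by (auto simp: inj_on_eq_iff)
  have edges: "{y, x} \<in> E" "{y, z} \<in> E" "{z, y} \<in> E" "{z, x} \<in> E" "{x, y} \<in> E" "{x, z} \<in> E"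
    using assms(2) by (simp_all add: insert_commute)
  assume "collinear {f x, f y, f z}"
  then consider "f x \<in> closed_segment (f y) (f z)" | "f y \<in> closed_segment (f z) (f x)" |
      "f z \<in> closed_segment (f x) (f y)"
    by (auto simp: collinear_between_cases between_mem_segment)
  then show False
  proof cases
    case 1
    then show ?thesis
      using plane_embedding_adjacent[OF assms(1) edges(1,2)] assms(3) ne by auto
  next
    case 2
    then show ?thesis
      using plane_embedding_adjacent[OF assms(1) edges(3,4)] assms(3) ne by auto
  next
    case 3
    then show ?thesis
      using plane_embedding_adjacent[OF assms(1) edges(5,6)] assms(3) ne by auto
  qed
qed

section \<open>A triangle joined to one neighbour\<close>

context
  fixes E :: "'v set set" and f :: "'v \<Rightarrow> complex" and a1 a2 a3 b1 b2 b3 :: 'v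
  assumes plane: "plane_embedding E f"
    and prism: "{{a1, a2}, {a2, a3}, {a3, a1}, {b1, b2}, {b2, b3}, {b3, b1},
        {a1, b1}, {a2, b2}, {a3, b3}} \<subseteq> E"
    and dist: "distinct [a1, a2, a3, b1, b2, b3]"
begin

lemma prism_web_connected: "connected (web (f a1) (f a2) (f a3) (f b1) (f b2) (f b3))"
proof -
  have "inj_on f (\<Union>E)" "{a1, a2, a3, b1, b2, b3} \<subseteq> \<Union>E"
    using plane prism by (auto simp: plane_embedding_def)
  then show ?thesis
    using dist by (intro web_connected) (auto simp: inj_on_eq_iff)
qed

lemma prism_web_avoids_triangle:
  "web (f a1) (f a2) (f a3) (f b1) (f b2) (f b3) \<inter>
     (closed_segment (f b1) (f b2) \<union> closed_segment (f b2) (f b3) \<union> closed_segment (f b3) (f b1)) = {}"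
proof -
  note disj = plane_embedding_disjoint[OF plane]
  \<comment> \<open>An edge at \<open>v\<close> meets the leg only in \<open>f v\<close>, which has
    been removed; an edge missing both ends of the leg does not meet it at all.\<close>
  have arm: "(closed_segment (f u) (f v) - {f v}) \<inter> closed_segment (f x) (f y) = {}"
    if uv: "{u, v} \<in> E" "{x, y} \<in> E" "u \<notin> {v, x, y}" for u v x y
  proof (cases "v \<in> {x, y}")
    case True
    then have "closed_segment (f v) (f u) \<inter> closed_segment (f x) (f y) \<subseteq> {f v}"
      using plane_embedding_adjacent[OF plane, of v u x] plane_embedding_adjacent[OF plane, of v u y] uv
      by (auto simp: insert_commute closed_segment_commute)
    then show ?thesis
      by (auto simp: closed_segment_commute)
  next
    case False
    then show ?thesis
      using disj[of u v x y] uv by blast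
  qed
  show ?thesis
    using prism dist
    by (simp add: web_def Int_Un_distrib Int_Un_distrib2 disj arm)
qed

text \<open>The web is connected and misses the drawn triangle, which is the frontier of the hull
  \<open>H\<close>. Hence it cannot cross between the interior of \<open>H\<close> and the
  complement.\<close>

lemma prism_nested_or_outside:
  defines "H \<equiv> convex hull {f b1, f b2, f b3}"
  shows "{f a1, f a2, f a3} \<subseteq> interior H \<or> web (f a1) (f a2) (f a3) (f b1) (f b2) (f b3) \<inter> H = {}"
proof -
  let ?W = "web (f a1) (f a2) (f a3) (f b1) (f b2) (f b3)"
  let ?T = "closed_segment (f b1) (f b2) \<union> closed_segment (f b2) (f b3) \<union> closed_segment (f b3) (f b1)"
  have T: "frontier H = ?T" "inside ?T = interior H"
    by (simp_all add: H_def frontier_of_triangle inside_of_triangle)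
  have "?W \<subseteq> interior H" if "?W \<inter> interior H \<noteq> {}"
    using connected_subset_inside[of ?T ?W] T that prism_web_connected prism_web_avoids_triangle
    by (metis frontier_closed open_interior)
  moreover have "{f a1, f a2, f a3} \<subseteq> ?W"
    by (auto simp: web_def)
  moreover have "H \<subseteq> interior H \<union> ?T"
    unfolding T(1)[symmetric] frontier_def using closure_subset by blast
  ultimately show ?thesis
    using prism_web_avoids_triangle by blast
qed

end

section \<open>A triangle between two neighbours\<close>

text \<open>An edge of one web shares a vertex with an edge of the other only if both are legs at
  the same corner, and there the common endpoint is left out of both webs.\<close>

lemma webs_disjoint:
  fixes f :: "'v \<Rightarrow> complex"
  assumes plane: "plane_embedding E f"
    and edges: "{{a1, a2}, {a2, a3}, {a3, a1}, {c1, c2}, {c2, c3}, {c3, c1},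
        {a1, b1}, {a2, b2}, {a3, b3}, {b1, c1}, {b2, c2}, {b3, c3}} \<subseteq> E"
    and dist: "distinct [a1, a2, a3, b1, b2, b3, c1, c2, c3]"
  shows "web (f a1) (f a2) (f a3) (f b1) (f b2) (f b3) \<inter> web (f c1) (f c2) (f c3) (f b1) (f b2) (f b3) = {}"
proof -
  note disj = plane_embedding_disjoint[OF plane]
  have disj': "closed_segment (f u) (f v) \<inter> (closed_segment (f x) (f y) - X) = {}"
    "(closed_segment (f u) (f v) - X) \<inter> closed_segment (f x) (f y) = {}"
    "(closed_segment (f u) (f v) - X) \<inter> (closed_segment (f x) (f y) - Y) = {}"
    if "{u, v} \<in> E" "{x, y} \<in> E" "{u, v} \<inter> {x, y} = {}" for u v x y X Y
    using disj[OF that] by blast+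
  have arm: "(closed_segment (f u) (f v) - {f v}) \<inter> (closed_segment (f w) (f v) - {f v}) = {}"
    if "{u, v} \<in> E" "{w, v} \<in> E" "u \<noteq> w" for u v w
    using plane_embedding_adjacent[OF plane, of v u w] that
    by (auto simp: insert_commute closed_segment_commute)
  have "{c1, b1} \<in> E" "{c2, b2} \<in> E" "{c3, b3} \<in> E"
    using edges by (simp_all add: insert_commute)
  moreover have "b2 \<noteq> b1" "b3 \<noteq> b1" "b3 \<noteq> b2"
    using dist by auto
  ultimately show ?thesis
    using edges dist
    by (simp add: web_def Int_Un_distrib Int_Un_distrib2 disj disj' arm)
qed

text \<open>By \<open>prism_nested_or_outside\<close>, a neighbour not inside the middle triangle
  keeps its entire web off the hull. Two such webs contradict
  \<open>no_two_webs_outside_triangle\<close>, whose hypotheses are read off the plane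
  embedding.\<close>

lemma nested_triangle_dichotomy:
  fixes f :: "'v \<Rightarrow> complex"
  assumes plane: "plane_embedding E f"
    and edges: "{{a1, a2}, {a2, a3}, {a3, a1}, {b1, b2}, {b2, b3}, {b3, b1}, {c1, c2}, {c2, c3}, {c3, c1},
        {a1, b1}, {a2, b2}, {a3, b3}, {b1, c1}, {b2, c2}, {b3, c3}} \<subseteq> E"
    and dist: "distinct [a1, a2, a3, b1, b2, b3, c1, c2, c3]"
  shows "f ` {a1, a2, a3} \<subseteq> interior (convex hull (f ` {b1, b2, b3})) \<or>
    f ` {c1, c2, c3} \<subseteq> interior (convex hull (f ` {b1, b2, b3}))"
proof (rule ccontr)
  assume neg: "\<not> ?thesis"
  then have not_nested: "\<not> {f a1, f a2, f a3} \<subseteq> interior (convex hull {f b1, f b2, f b3})"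
    "\<not> {f c1, f c2, f c3} \<subseteq> interior (convex hull {f b1, f b2, f b3})"
    by (simp_all only: image_insert image_empty de_Morgan_disj not_False_eq_True)
  have prism_a: "{{a1, a2}, {a2, a3}, {a3, a1}, {b1, b2}, {b2, b3}, {b3, b1},
      {a1, b1}, {a2, b2}, {a3, b3}} \<subseteq> E" and dist_a: "distinct [a1, a2, a3, b1, b2, b3]"
    using edges dist by simp_all
  have prism_c: "{{c1, c2}, {c2, c3}, {c3, c1}, {b1, b2}, {b2, b3}, {b3, b1},
      {c1, b1}, {c2, b2}, {c3, b3}} \<subseteq> E" and dist_c: "distinct [c1, c2, c3, b1, b2, b3]"
    using edges dist by (simp_all add: insert_commute) auto
  have A: "web (f a1) (f a2) (f a3) (f b1) (f b2) (f b3) \<inter> convex hull {f b1, f b2, f b3} = {}"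
    using prism_nested_or_outside[OF plane prism_a dist_a]
    by (simp only: not_nested simp_thms)
  have C: "web (f c1) (f c2) (f c3) (f b1) (f b2) (f b3) \<inter> convex hull {f b1, f b2, f b3} = {}"
    using prism_nested_or_outside[OF plane prism_c dist_c]
    by (simp only: not_nested simp_thms)
  have AC: "web (f a1) (f a2) (f a3) (f b1) (f b2) (f b3) \<inter> web (f c1) (f c2) (f c3) (f b1) (f b2) (f b3) = {}"
    using edges dist by (intro webs_disjoint[OF plane]) simp_all
  have ncol: "\<not> collinear {f b1, f b2, f b3}"
    using edges dist by (intro triangle_not_collinear[OF plane]) simp_all
  have edges_flip: "{a2, a1} \<in> E" "{a1, a3} \<in> E" "{a3, a2} \<in> E"
    using edges by (simp_all add: insert_commute)
  note disj = plane_embedding_disjoint[OF plane] and adj = plane_embedding_adjacent[OF plane]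
  \<comment> \<open>The reversed list supplies every inequality in the opposite orientation.\<close>
  have "distinct [c3, c2, c1, b3, b2, b1, a3, a2, a1]"
    using dist by auto
  note dist = dist this
  show False
  proof (rule no_two_webs_outside_triangle[OF ncol A C AC])
    show "closed_segment (f a1) (f b1) \<inter> closed_segment (f a2) (f b2) = {}"
      "closed_segment (f a1) (f b1) \<inter> closed_segment (f a3) (f b3) = {}"
      "closed_segment (f a2) (f b2) \<inter> closed_segment (f a3) (f b3) = {}"
      "closed_segment (f a2) (f b2) \<inter> closed_segment (f a1) (f a3) = {}"
      "closed_segment (f a3) (f b3) \<inter> closed_segment (f a1) (f a2) = {}"
      by (rule disj; use edges edges_flip dist in simp)+
    show "closed_segment (f a1) (f b1) \<inter> closed_segment (f a1) (f a2) \<subseteq> {f a1}"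
      "closed_segment (f a1) (f b1) \<inter> closed_segment (f a1) (f a3) \<subseteq> {f a1}"
      "closed_segment (f a1) (f a2) \<inter> closed_segment (f a1) (f a3) \<subseteq> {f a1}"
      by (rule adj; use edges edges_flip dist in simp)+
    show "closed_segment (f a2) (f b2) \<inter> closed_segment (f a1) (f a2) \<subseteq> {f a2}"
      unfolding closed_segment_commute[of "f a1"] by (rule adj; use edges edges_flip dist in simp)
    show "closed_segment (f a3) (f b3) \<inter> closed_segment (f a1) (f a3) \<subseteq> {f a3}"
      unfolding closed_segment_commute[of "f a1"] by (rule adj; use edges edges_flip dist in simp)
  qed
qed

section \<open>Long chains of nested triangles\<close>

text \<open>A straight edge is the convex hull of its drawn endpoints, which turns the crossing
  condition of \<open>planar_drawing\<close> into that of \<open>plane_embedding\<close>.\<close>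

lemma plane_embedding_of_drawing:
  assumes "simple_graph G" "drawing_of G \<Gamma>" "planar_drawing G \<Gamma>" "straight_line_drawing G \<Gamma>"
  shows "plane_embedding (edges G) (pos \<Gamma>)"
proof -
  have curve: "curve \<Gamma> e = convex hull (pos \<Gamma> ` e)" if e: "e \<in> edges G" for e
  proof -
    have "card e = 2"
      using assms(1) e by (simp add: simple_graph_def)
    then obtain u v where "e = {u, v}"
      by (auto simp: card_2_iff)
    then show ?thesis
      using assms(4) e by (simp add: straight_line_drawing_def segment_convex_hull)
  qed
  have "\<Union>(edges G) \<subseteq> verts G"
    using assms(1) by (auto simp: simple_graph_def)
  moreover have "inj_on (pos \<Gamma>) (verts G)"
    using assms(2) by (simp add: drawing_of_def)
  ultimately have "inj_on (pos \<Gamma>) (\<Union>(edges G))"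
    by (rule inj_on_subset[rotated])
  moreover have "convex hull (pos \<Gamma> ` d) \<inter> convex hull (pos \<Gamma> ` e) \<subseteq> pos \<Gamma> ` (d \<inter> e)"
    if "d \<in> edges G" "e \<in> edges G" "d \<noteq> e" for d e
    using assms(3) that by (simp add: planar_drawing_def flip: curve)
  ultimately show ?thesis
    by (simp add: plane_embedding_def)
qed

text \<open>Moves a drawing from \<open>real \<times> real\<close> to \<open>complex\<close>, where
  the theta curve argument takes place. Linear maps commute with hulls, injective maps with
  intersections.\<close>

lemma plane_embedding_linear_image:
  assumes "plane_embedding E f" "linear h" "inj h"
  shows "plane_embedding E (h \<circ> f)"
proof -
  have "convex hull ((h \<circ> f) ` d) \<inter> convex hull ((h \<circ> f) ` e) \<subseteq> (h \<circ> f) ` (d \<inter> e)"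
    if "d \<in> E" "e \<in> E" "d \<noteq> e" for d e
  proof -
    have hull: "convex hull ((h \<circ> f) ` x) = h ` (convex hull (f ` x))" for x
      by (simp only: image_comp[symmetric] convex_hull_linear_image[OF assms(2)])
    have "convex hull ((h \<circ> f) ` d) \<inter> convex hull ((h \<circ> f) ` e) =
        h ` (convex hull (f ` d) \<inter> convex hull (f ` e))"
      by (simp only: hull image_Int[OF assms(3)])
    also have "\<dots> \<subseteq> h ` f ` (d \<inter> e)"
      using assms(1) that unfolding plane_embedding_def by blast
    finally show ?thesis
      by (simp only: image_comp)
  qed
  moreover have "inj_on (h \<circ> f) (\<Union>E)"
    using assms by (auto simp: plane_embedding_def inj_on_def dest: injD)
  ultimately show ?thesis
    by (simp add: plane_embedding_def)
qed

lemma plane_embedding_cong: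
  assumes "plane_embedding E f" "\<And>v. v \<in> \<Union>E \<Longrightarrow> f v = g v"
  shows "plane_embedding E g"
proof -
  have "f ` d = g ` d" "f ` (d \<inter> e) = g ` (d \<inter> e)" if "d \<in> E" for d e
    using assms(2) that by (auto intro!: image_cong)
  moreover have "inj_on g (\<Union>E)"
    using assms inj_on_cong[of "\<Union>E" f g] unfolding plane_embedding_def by blast
  ultimately show ?thesis
    using assms(1) by (simp add: plane_embedding_def)
qed

section \<open>Strict containment and chains\<close>

text \<open>Otherwise the hull would lie in the closed half-space bounded by the hyperplane through
  \<open>p\<close> normal to \<open>a\<close>, and its interior in the open half-space, which misses
  \<open>p\<close>.\<close>

lemma interior_hull_exceeded:
  fixes a :: "'a::euclidean_space"
  assumes "a \<noteq> 0" "p \<in> interior (convex hull S)"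
  obtains s where "s \<in> S" "a \<bullet> p < a \<bullet> s"
proof -
  have False if le: "\<And>s. s \<in> S \<Longrightarrow> a \<bullet> s \<le> a \<bullet> p"
  proof -
    have "convex hull S \<subseteq> {x. a \<bullet> x \<le> a \<bullet> p}"
      using le by (intro hull_minimal convex_halfspace_le) auto
    then have "p \<in> {x. a \<bullet> x < a \<bullet> p}"
      using assms interior_halfspace_le[OF assms(1), of "a \<bullet> p"] interior_mono by blast
    then show False
      by simp
  qed
  then show ?thesis
    using that by force
qed

text \<open>Under mutual containment, a point of \<open>S\<close> extreme in some direction would be
  exceeded by a point of \<open>T\<close>, and that one by another point of
  \<open>S\<close>.\<close>

lemma interior_hull_asym:
  fixes S T :: "'a::euclidean_space set"
  assumes "finite S" "S \<noteq> {}" "S \<subseteq> interior (convex hull T)"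
  shows "\<not> T \<subseteq> interior (convex hull S)"
proof
  assume TS: "T \<subseteq> interior (convex hull S)"
  obtain a :: 'a where a: "a \<noteq> 0"
    using nonzero_Basis nonempty_Basis by blast
  obtain s where s: "s \<in> S" "\<And>x. x \<in> S \<Longrightarrow> a \<bullet> x \<le> a \<bullet> s"
  proof -
    have "Max ((\<bullet>) a ` S) \<in> (\<bullet>) a ` S"
      using assms by (intro Max_in) auto
    then obtain s where "s \<in> S" "Max ((\<bullet>) a ` S) = a \<bullet> s"
      by blast
    moreover have "a \<bullet> x \<le> Max ((\<bullet>) a ` S)" if "x \<in> S" for x
      using that assms(1) by simp
    ultimately show ?thesis
      using that by simp
  qed
  obtain t where t: "t \<in> T" "a \<bullet> s < a \<bullet> t"
    using interior_hull_exceeded[OF a, of s T] assms(3) s(1) by blast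
  obtain x where "x \<in> S" "a \<bullet> t < a \<bullet> x"
    using interior_hull_exceeded[OF a, of t S] TS t(1) by blast
  then show False
    using s(2) t(2) by fastforce
qed

text \<open>Read \<open>nest i j\<close> as triangle \<open>i\<close> lying strictly inside triangle
  \<open>j\<close>, and \<open>spread i d\<close> as triangle \<open>i\<close> having extent at
  least \<open>d\<close>. Once a middle triangle contains a neighbour, asymmetry rules out the other
  alternative at each later triangle on that side, so the nesting continues to the end of the
  sequence.\<close>

lemma long_nested_chain:
  fixes nest :: "nat \<Rightarrow> nat \<Rightarrow> bool" and spread :: "nat \<Rightarrow> nat \<Rightarrow> bool"
  assumes dichotomy: "\<And>i. i + 2 < m \<Longrightarrow> nest i (i + 1) \<or> nest (i + 2) (i + 1)"
    and asym: "\<And>i j. nest i j \<Longrightarrow> \<not> nest j i"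
    and grow: "\<And>i j d. i < m \<Longrightarrow> j < m \<Longrightarrow> nest i j \<Longrightarrow> spread i d \<Longrightarrow> spread j (d + 2)"
    and start: "\<And>i. i < m \<Longrightarrow> spread i 0"
    and "3 \<le> m"
  obtains k d where "k < m" "m \<le> d + 2" "spread k d"
proof -
  \<comment> \<open>The middle triangle is \<open>k + 1 = m div 2\<close>, which leaves about half
    of the sequence on either side.\<close>
  define k where "k = m div 2 - 1"
  have k: "k + 2 < m"
    using \<open>3 \<le> m\<close> unfolding k_def by linarith
  from dichotomy[OF k] show thesis
  proof
    assume nest: "nest (k + 2) (k + 1)"
    have down: "nest (i + 1) i" if "k + 1 \<le> i" "i + 1 < m" for i
      using that
    proof (induction i rule: dec_induct)
      case base
      show ?case
        using nest by simp
    next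
      case (step i)
      then show ?case
        using dichotomy[of i] asym[of "i + 1" i] by simp
    qed
    \<comment> \<open>The innermost triangle is the last one, \<open>m - 1\<close>; each step back
      towards \<open>k + 1\<close> adds 2. The \<open>m - 2 - k\<close> steps give exactly
      \<open>m - 2\<close> for even \<open>m\<close>, whence the bound
      \<open>m \<le> d + 2\<close>.\<close>
    have "spread (m - 1 - d) (2 * d)" if "d \<le> m - 2 - k" for d
      using that
    proof (induction d)
      case 0
      then show ?case
        using start \<open>3 \<le> m\<close> by simp
    next
      case (Suc d)
      have "nest (m - 1 - Suc d + 1) (m - 1 - Suc d)"
        using Suc.prems k by (intro down) linarith+
      moreover have "m - 1 - Suc d + 1 = m - 1 - d"
        using Suc.prems by linarith
      ultimately have "spread (m - 1 - Suc d) (2 * d + 2)"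
        using Suc k by (intro grow[of "m - 1 - d"]) simp_all
      then show ?case
        by simp
    qed
    from this[of "m - 2 - k"] show thesis
      using k by (intro that[of "m - 1 - (m - 2 - k)" "2 * (m - 2 - k)"]) (simp_all add: k_def)
  next
    assume nest: "nest k (k + 1)"
    have up: "nest i (i + 1)" if "i \<le> k" for i
      using that
    proof (induction i rule: inc_induct)
      case base
      show ?case
        using nest by simp
    next
      case (step i)
      then show ?case
        using dichotomy[of i] asym[of "i + 1" "i + 2"] k by simp
    qed
    \<comment> \<open>Now triangle 0 is innermost and the extent grows up to the middle.\<close>
    have "spread i (2 * i)" if "i \<le> k + 1" for i
      using that
    proof (induction i)
      case 0
      then show ?case
        using start k by simp
    next
      case (Suc i)
      then show ?case
        using grow[of i "i + 1" "2 * i"] up[of i] k by simp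
    qed
    from this[of "k + 1"] show thesis
      using k by (intro that[of "k + 1" "2 * (k + 1)"]) (simp_all add: k_def)
  qed
qed

section \<open>The story of the nested triangles graph\<close>

lemma nested_triangles_triangle_edges:
  assumes "3 * j + 3 \<le> n"
  shows "{{3 * j + 1, 3 * j + 2}, {3 * j + 2, 3 * j + 3}, {3 * j + 3, 3 * j + 1}}
    \<subseteq> edges (nested_triangles n)"
proof -
  have "3 * j + 3 \<in> {i \<in> {3..n}. 3 dvd i}"
    using assms by simp
  then have "{{3 * j + 3 - 2, 3 * j + 3 - 1}, {3 * j + 3 - 1, 3 * j + 3}, {3 * j + 3, 3 * j + 3 - 2}}
      \<subseteq> edges (nested_triangles n)"
    unfolding nested_triangles_def ugraph.simps by blast
  then show ?thesis
    by simp
qed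

lemma nested_triangles_connecting_edge:
  assumes "1 \<le> v" "v + 3 \<le> n"
  shows "{v, v + 3} \<in> edges (nested_triangles n)"
  using assms unfolding nested_triangles_def ugraph.simps by blast

text \<open>Triangles are counted from 0, so triangle \<open>j\<close> is the 3-cycle whose last
  vertex is \<open>3 * j + 3\<close>.\<close>

definition triangle_vertices :: "nat \<Rightarrow> nat set" where
  "triangle_vertices j = {3 * j + 1, 3 * j + 2, 3 * j + 3}"

text \<open>At time \<open>3 * j + 9\<close> the window of size 9 shows exactly the vertices
  \<open>3 * j + 1\<close> to \<open>3 * j + 9\<close>, that is, three complete triangles with the
  edges between them.\<close>

lemma story_window_edges:
  assumes "3 * j + 9 \<le> n"
  shows "{{3*j+1, 3*j+2}, {3*j+2, 3*j+3}, {3*j+3, 3*j+1},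
      {3*j+4, 3*j+5}, {3*j+5, 3*j+6}, {3*j+6, 3*j+4},
      {3*j+7, 3*j+8}, {3*j+8, 3*j+9}, {3*j+9, 3*j+7},
      {3*j+1, 3*j+4}, {3*j+2, 3*j+5}, {3*j+3, 3*j+6},
      {3*j+4, 3*j+7}, {3*j+5, 3*j+8}, {3*j+6, 3*j+9}}
    \<subseteq> edges (story_graph (nested_triangles n) (\<lambda>i. i) 9 (3 * j + 9))"
proof -
  have "{{3*j+1, 3*j+2}, {3*j+2, 3*j+3}, {3*j+3, 3*j+1}} \<subseteq> edges (nested_triangles n)"
    using assms by (intro nested_triangles_triangle_edges) simp
  moreover have "{{3*j+4, 3*j+5}, {3*j+5, 3*j+6}, {3*j+6, 3*j+4}} \<subseteq> edges (nested_triangles n)"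
    using assms nested_triangles_triangle_edges[of "j + 1" n] by (simp add: algebra_simps)
  moreover have "{{3*j+7, 3*j+8}, {3*j+8, 3*j+9}, {3*j+9, 3*j+7}} \<subseteq> edges (nested_triangles n)"
    using assms nested_triangles_triangle_edges[of "j + 2" n] by (simp add: algebra_simps)
  moreover have "{{3*j+1, 3*j+4}, {3*j+2, 3*j+5}, {3*j+3, 3*j+6},
      {3*j+4, 3*j+7}, {3*j+5, 3*j+8}, {3*j+6, 3*j+9}} \<subseteq> edges (nested_triangles n)"
    using assms nested_triangles_connecting_edge[of "3*j+1" n] nested_triangles_connecting_edge[of "3*j+2" n]
      nested_triangles_connecting_edge[of "3*j+3" n] nested_triangles_connecting_edge[of "3*j+4" n]
      nested_triangles_connecting_edge[of "3*j+5" n] nested_triangles_connecting_edge[of "3*j+6" n]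
    by (simp add: algebra_simps)
  ultimately show ?thesis
    unfolding story_graph_def induced_subgraph_def ugraph.simps by simp
qed

text \<open>Makes \<open>pos (\<Gamma> v) v\<close> a time-independent name for the point at which
  \<open>v\<close> is drawn.\<close>

lemma vertex_visible_at_own_time:
  assumes "v \<in> {1..n}"
  shows "v \<in> story_times (nested_triangles n) 9"
    "v \<in> verts (story_graph (nested_triangles n) (\<lambda>i. i) 9 v)"
  using assms
  by (simp_all add: story_times_def story_graph_def induced_subgraph_def nested_triangles_def)

text \<open>Since vertices never move, one map \<open>f\<close> describes the drawings at all times.
  This lets the containments found in different windows be chained.\<close>

lemma nested_triangles_story_dichotomy:
  fixes \<Gamma> :: "nat \<Rightarrow> nat drawing" and h :: "real \<times> real \<Rightarrow> complex"
  assumes story: "drawing_story (nested_triangles n) (\<lambda>i. i) 9 \<Gamma>"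
    and planar: "planar_story (nested_triangles n) (\<lambda>i. i) 9 \<Gamma>"
    and straight: "straight_line_story (nested_triangles n) (\<lambda>i. i) 9 \<Gamma>"
    and "3 * j + 9 \<le> n" and h: "linear h" "inj h"
  defines "f \<equiv> \<lambda>v. h (pos (\<Gamma> v) v)"
  shows "f ` triangle_vertices j \<subseteq> interior (convex hull (f ` triangle_vertices (j + 1))) \<or>
    f ` triangle_vertices (j + 2) \<subseteq> interior (convex hull (f ` triangle_vertices (j + 1)))"
proof -
  let ?t = "3 * j + 9"
  let ?G = "story_graph (nested_triangles n) (\<lambda>i. i) 9"
  let ?times = "story_times (nested_triangles n) 9"
  have t: "?t \<in> ?times"
    using assms(4) by (simp add: story_times_def nested_triangles_def)
  have "simple_graph (nested_triangles n)"
    using story by (simp add: drawing_story_def graph_story_def)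
  then have simple: "simple_graph (?G ?t)"
    by (auto simp: simple_graph_def story_graph_def induced_subgraph_def)
  then have "plane_embedding (edges (?G ?t)) (pos (\<Gamma> ?t))"
    using story planar straight t
    by (intro plane_embedding_of_drawing)
      (auto simp: drawing_story_def planar_story_def straight_line_story_def)
  then have "plane_embedding (edges (?G ?t)) (h \<circ> pos (\<Gamma> ?t))"
    using h by (rule plane_embedding_linear_image)
  moreover have "(h \<circ> pos (\<Gamma> ?t)) v = f v" if "v \<in> \<Union>(edges (?G ?t))" for v
  proof -
    have v: "v \<in> verts (?G ?t)"
      using that simple by (auto simp: simple_graph_def)
    then have "v \<in> {1..n}"
      by (simp add: story_graph_def induced_subgraph_def nested_triangles_def)
    then have "v \<in> verts (?G v)" "v \<in> ?times"
      by (simp_all only: vertex_visible_at_own_time)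
    then have "pos (\<Gamma> ?t) v = pos (\<Gamma> v) v"
      using story t v unfolding drawing_story_def by blast
    then show ?thesis
      by (simp add: f_def)
  qed
  ultimately have plane: "plane_embedding (edges (?G ?t)) f"
    by (rule plane_embedding_cong)
  have vertices: "triangle_vertices j = {3*j+1, 3*j+2, 3*j+3}"
    "triangle_vertices (j + 1) = {3*j+4, 3*j+5, 3*j+6}"
    "triangle_vertices (j + 2) = {3*j+7, 3*j+8, 3*j+9}"
    by (simp_all add: triangle_vertices_def algebra_simps)
  show ?thesis
    unfolding vertices
    by (rule nested_triangle_dichotomy[OF plane story_window_edges[OF assms(4)]]) simp
qed

text \<open>Integer coordinates turn each strict inclusion into a gain of at least one grid line on
  either side, in every integral direction \<open>a\<close>.\<close>

lemma nested_triangles_extent: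
  fixes f :: "nat \<Rightarrow> complex" and a :: complex
  assumes n: "9 \<le> n" "n mod 3 = 0" and "a \<noteq> 0"
    and dichotomy: "\<And>j. 3 * j + 9 \<le> n \<Longrightarrow>
      f ` triangle_vertices j \<subseteq> interior (convex hull (f ` triangle_vertices (j + 1))) \<or>
      f ` triangle_vertices (j + 2) \<subseteq> interior (convex hull (f ` triangle_vertices (j + 1)))"
    and grid: "\<And>v. v \<in> {1..n} \<Longrightarrow> a \<bullet> f v \<in> \<int>"
    and bounds: "\<And>v. v \<in> {1..n} \<Longrightarrow> lo \<le> a \<bullet> f v \<and> a \<bullet> f v \<le> hi"
  shows "real n / 9 \<le> hi - lo + 1"
proof -
  define m where "m = n div 3"
  define nest where
    "nest i j \<longleftrightarrow> f ` triangle_vertices i \<subseteq> interior (convex hull (f ` triangle_vertices j))" for i j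
  define spread where
    "spread j d \<longleftrightarrow> (\<exists>u\<in>triangle_vertices j. \<exists>v\<in>triangle_vertices j. real d \<le> a \<bullet> f v - a \<bullet> f u)" for j d
  have m: "n = 3 * m" "3 \<le> m"
    using n by (auto simp: m_def)
  have vertices: "triangle_vertices j \<subseteq> {1..n}" if "j < m" for j
    using that m by (auto simp: triangle_vertices_def)
  obtain k d where kd: "k < m" "m \<le> d + 2" "spread k d"
  proof (rule long_nested_chain[of m nest spread])
    show "nest i (i + 1) \<or> nest (i + 2) (i + 1)" if "i + 2 < m" for i
      unfolding nest_def using that m by (intro dichotomy) simp
    show "\<not> nest j i" if "nest i j" for i j
      using that unfolding nest_def by (intro interior_hull_asym) (auto simp: triangle_vertices_def)
    show "spread i 0" if "i < m" for i
      by (auto simp: spread_def triangle_vertices_def)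
    show "spread j (d + 2)" if ij: "i < m" "j < m" "nest i j" "spread i d" for i j d
    proof -
      obtain u v where uv: "u \<in> triangle_vertices i" "v \<in> triangle_vertices i"
          "real d \<le> a \<bullet> f v - a \<bullet> f u"
        using ij(4) by (auto simp: spread_def)
      have "f v \<in> interior (convex hull (f ` triangle_vertices j))"
        "f u \<in> interior (convex hull (f ` triangle_vertices j))"
        using ij(3) uv by (auto simp: nest_def)
      then obtain v' u' where v': "v' \<in> triangle_vertices j" "a \<bullet> f v < a \<bullet> f v'"
        and u': "u' \<in> triangle_vertices j" "a \<bullet> f u' < a \<bullet> f u"
        \<comment> \<open>Direction \<open>a\<close> yields a corner beyond \<open>f v\<close>, and
          direction \<open>- a\<close> one beyond \<open>f u\<close> on the other side.\<close>
        using interior_hull_exceeded[of a "f v"] interior_hull_exceeded[of "- a" "f u"] \<open>a \<noteq> 0\<close>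
        by (smt (verit) imageE inner_minus_left neg_equal_0_iff_equal)
      have gap: "x + 1 \<le> y" if "x \<in> \<int>" "y \<in> \<int>" "x < y" for x y :: real
        using that by (auto elim!: Ints_cases)
      have "a \<bullet> f v + 1 \<le> a \<bullet> f v'" "a \<bullet> f u' + 1 \<le> a \<bullet> f u"
        using uv v' u' vertices[OF ij(1)] vertices[OF ij(2)] grid by (auto intro!: gap)
      then show ?thesis
        using v' u' uv(3) unfolding spread_def by force
    qed
  qed (use m in auto)
  then obtain u v where "u \<in> {1..n}" "v \<in> {1..n}" "real d \<le> a \<bullet> f v - a \<bullet> f u"
    using vertices[OF kd(1)] unfolding spread_def by blast
  then have "real d \<le> hi - lo"
    using bounds[of u] bounds[of v] by linarith
  moreover have "real n = 3 * real m" "real m \<le> real d + 2"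
    using m kd(2) by simp_all
  \<comment> \<open>\<open>hi - lo + 1\<close> is at least \<open>d + 1\<close>, so at least
    \<open>m - 1\<close>, which is at least \<open>m / 3 = n / 9\<close> because
    \<open>m \<ge> 3\<close>.\<close>
  ultimately show ?thesis
    using m(2) by linarith
qed

theorem theorem1:
  "\<exists>c::real. c > 0 \<and>
     (\<forall>n::nat. n \<ge> 9 \<longrightarrow> n mod 3 = 0 \<longrightarrow>
       (\<forall>\<Gamma> :: nat \<Rightarrow> nat drawing.
          drawing_story (nested_triangles n) (\<lambda>i. i) 9 \<Gamma> \<longrightarrow>
          planar_story (nested_triangles n) (\<lambda>i. i) 9 \<Gamma> \<longrightarrow>
          straight_line_story (nested_triangles n) (\<lambda>i. i) 9 \<Gamma> \<longrightarrow>
          grid_story (nested_triangles n) (\<lambda>i. i) 9 \<Gamma> \<longrightarrow>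
          (\<forall>x\<^sub>1 x\<^sub>2 y\<^sub>1 y\<^sub>2 :: int. x\<^sub>1 < x\<^sub>2 \<longrightarrow> y\<^sub>1 < y\<^sub>2 \<longrightarrow>
             story_enclosed (nested_triangles n) (\<lambda>i. i) 9 \<Gamma> x\<^sub>1 x\<^sub>2 y\<^sub>1 y\<^sub>2 \<longrightarrow>
             c * real n \<le> of_int (grid_extent x\<^sub>1 x\<^sub>2) \<and>
             c * real n \<le> of_int (grid_extent y\<^sub>1 y\<^sub>2))))"
proof (intro exI[of _ "1 / 9"] conjI allI impI)
  fix n :: nat and \<Gamma> :: "nat \<Rightarrow> nat drawing" and x\<^sub>1 x\<^sub>2 y\<^sub>1 y\<^sub>2 :: int
  assume n: "9 \<le> n" "n mod 3 = 0"
    and story: "drawing_story (nested_triangles n) (\<lambda>i. i) 9 \<Gamma>"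
    and planar: "planar_story (nested_triangles n) (\<lambda>i. i) 9 \<Gamma>"
    and straight: "straight_line_story (nested_triangles n) (\<lambda>i. i) 9 \<Gamma>"
    and grid: "grid_story (nested_triangles n) (\<lambda>i. i) 9 \<Gamma>"
    and enclosed: "story_enclosed (nested_triangles n) (\<lambda>i. i) 9 \<Gamma> x\<^sub>1 x\<^sub>2 y\<^sub>1 y\<^sub>2"
  define h :: "real \<times> real \<Rightarrow> complex" where "h p = Complex (fst p) (snd p)" for p
  define f where "f v = h (pos (\<Gamma> v) v)" for v
  have h: "linear h" "inj h"
    by (auto simp: h_def linear_iff complex_eq_iff inj_on_def prod_eq_iff)
  have dichotomy: "f ` triangle_vertices j \<subseteq> interior (convex hull (f ` triangle_vertices (j + 1))) \<or>
      f ` triangle_vertices (j + 2) \<subseteq> interior (convex hull (f ` triangle_vertices (j + 1)))"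
    if "3 * j + 9 \<le> n" for j
    unfolding f_def by (rule nested_triangles_story_dichotomy[OF story planar straight that h])
  \<comment> \<open>The two coordinates are inner products with \<open>1\<close> and
    \<open>\<i>\<close>, so width and height are two instances of
    \<open>nested_triangles_extent\<close>.\<close>
  have coords: "1 \<bullet> f v = fst (pos (\<Gamma> v) v)" "\<i> \<bullet> f v = snd (pos (\<Gamma> v) v)" for v
    by (simp_all add: f_def h_def inner_complex_def)
  note own_time = vertex_visible_at_own_time
  have on_grid: "1 \<bullet> f v \<in> \<int>" "\<i> \<bullet> f v \<in> \<int>" if "v \<in> {1..n}" for v
    using grid own_time[OF that] unfolding coords grid_story_def grid_drawing_def by blast+
  have "pos (\<Gamma> v) v \<in> {of_int x\<^sub>1..of_int x\<^sub>2} \<times> {of_int y\<^sub>1..of_int y\<^sub>2}" if "v \<in> {1..n}" for v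
    using enclosed own_time[OF that] unfolding story_enclosed_def drawn_points_def by blast
  then have bounds: "of_int x\<^sub>1 \<le> 1 \<bullet> f v \<and> 1 \<bullet> f v \<le> of_int x\<^sub>2"
    "of_int y\<^sub>1 \<le> \<i> \<bullet> f v \<and> \<i> \<bullet> f v \<le> of_int y\<^sub>2" if "v \<in> {1..n}" for v
    using that unfolding coords by (fastforce simp: mem_Times_iff)+
  have "real n / 9 \<le> of_int x\<^sub>2 - of_int x\<^sub>1 + 1"
    by (rule nested_triangles_extent[OF n _ dichotomy on_grid(1) bounds(1)]) auto
  then show "1 / 9 * real n \<le> of_int (grid_extent x\<^sub>1 x\<^sub>2)"
    by (simp add: grid_extent_def)
  have "real n / 9 \<le> of_int y\<^sub>2 - of_int y\<^sub>1 + 1"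
    by (rule nested_triangles_extent[OF n _ dichotomy on_grid(2) bounds(2)]) auto
  then show "1 / 9 * real n \<le> of_int (grid_extent y\<^sub>1 y\<^sub>2)"
    by (simp add: grid_extent_def)
qed simp

end
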